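(* Let $m, n, t$ be natural numbers such that $m = t^{2} + 2$ and $t \ge 12$. If the diophantine equation $|x^{2} - m y^{2}| = n$ has solutions $x, y \in \mathbb{Z}$ and if neither $n$ nor $2n$ is a perfect square, then $n = 2t - 1$, or $n = 2t + 1$, or $n = 4t - 7$, or $n = 4t - 2$, or $n \ge 4t + 2$.
   Context: Natural numbers are positive integers. A perfect square is the square of an integer. *)

theory Defs
  imports "HOL-Computational_Algebra.Nth_Powers"
begin

end

theory Submission
  imports Defs
begin

text \<open>
  Write \<open>m = t\<^sup>2 + 2\<close>. The ring \<open>\<int>[\<surd>m]\<close> contains the unit \<open>t\<^sup>2 + 1 + t\<surd>m\<close> of norm 1,
  and multiplying a solution by a power of it moves \<open>y\<close> into a fundamental range: among all
  solutions with \<open>x, y \<ge> 0\<close>, one with the least \<open>y\<close> has \<open>2y\<^sup>2 \<le> n\<close>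
  (lemma \<open>exists_solution_small_y\<close>). If \<open>n \<le> 4t + 1\<close>, then \<open>y\<close> has order at most \<open>\<surd>t\<close>.

  Now put \<open>x = ty + k\<close>, so that the norm becomes \<open>2tyk + k\<^sup>2 - 2y\<^sup>2\<close>. Here \<open>y = 0\<close> makes \<open>n\<close> a
  square, and \<open>k = 0\<close> makes \<open>2n\<close> a square. Otherwise the term \<open>2tyk\<close> dominates, so the value is
  small only when \<open>y\<close> and \<open>k\<close> are. For \<open>k > 0\<close> the values below \<open>4t + 2\<close> are \<open>2t - 1\<close>
  (\<open>y = k = 1\<close>) and \<open>4t - 7\<close> (\<open>y = 2\<close>, \<open>k = 1\<close>). For \<open>k < 0\<close>, where \<open>x \<ge> 0\<close> means
  \<open>-k \<le> ty\<close>, they are \<open>2t + 1\<close> and \<open>4t - 2\<close> (\<open>y = 1\<close>, \<open>k = -1\<close> and \<open>k = -2\<close>).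
\<close>

text \<open>
  The signs of \<open>x\<close> and \<open>y\<close> do not matter, so let both be nonnegative. Multiplication by
  \<open>t\<^sup>2 + 1 - t\<surd>m\<close> replaces \<open>y\<close> by \<open>(t\<^sup>2 + 1)y - tx\<close>. If \<open>y\<close> is already
  minimal, this has absolute value at least \<open>y\<close>, which leaves two cases: either \<open>x \<le> ty\<close>, where
  the norm is at most \<open>-2y\<^sup>2\<close>, or \<open>tx \<ge> my\<close>, where it is at least \<open>2y\<^sup>2\<close>.
\<close>

lemma exists_solution_small_y:
  fixes t x y n :: int
  assumes t: "t > 0" and sol: "\<bar>x\<^sup>2 - (t\<^sup>2 + 2) * y\<^sup>2\<bar> = n"
  shows "\<exists>x y. x \<ge> 0 \<and> y \<ge> 0 \<and> \<bar>x\<^sup>2 - (t\<^sup>2 + 2) * y\<^sup>2\<bar> = n \<and> 2 * y\<^sup>2 \<le> n"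
  using sol
proof (induction "nat \<bar>y\<bar>" arbitrary: x y rule: less_induct)
  case less
  define a where "a = \<bar>x\<bar>"
  define b where "b = \<bar>y\<bar>"
  have nonneg: "a \<ge> 0" "b \<ge> 0" and sol_ab: "\<bar>a\<^sup>2 - (t\<^sup>2 + 2) * b\<^sup>2\<bar> = n"
    using less.prems by (simp_all add: a_def b_def)
  define x' where "x' = (t\<^sup>2 + 1) * a - t * (t\<^sup>2 + 2) * b"
  define y' where "y' = (t\<^sup>2 + 1) * b - t * a"
  have norm: "x'\<^sup>2 - (t\<^sup>2 + 2) * y'\<^sup>2 = a\<^sup>2 - (t\<^sup>2 + 2) * b\<^sup>2"
    unfolding x'_def y'_def by algebra
  show ?case
  proof (cases "\<bar>y'\<bar> < b")
    case True
    then have "nat \<bar>y'\<bar> < nat \<bar>y\<bar>"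
      using nonneg by (simp add: b_def)
    then show ?thesis
      using norm sol_ab by (intro less.hyps[of y' x']) simp_all
  next
    case False
    then consider (neg) "y' \<ge> b" | (pos) "- y' \<ge> b"
      by linarith
    then have "2 * b\<^sup>2 \<le> n"
    proof cases
      case neg
      then have "t * a \<le> t * (t * b)"
        by (simp add: y'_def algebra_simps power2_eq_square)
      then have "a \<le> t * b"
        using t by simp
      then have "a\<^sup>2 \<le> (t * b)\<^sup>2"
        using nonneg by (intro power_mono)
      then show ?thesis
        using sol_ab by (simp add: algebra_simps power_mult_distrib)
    next
      case pos
      then have "(t\<^sup>2 + 2) * b \<le> t * a"
        by (simp add: y'_def algebra_simps)
      then have "((t\<^sup>2 + 2) * b)\<^sup>2 \<le> (t * a)\<^sup>2"
        using nonneg by (intro power_mono) simp_all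
      then have "t\<^sup>2 * (2 * b\<^sup>2) + 4 * b\<^sup>2 \<le> t\<^sup>2 * (a\<^sup>2 - (t\<^sup>2 + 2) * b\<^sup>2)"
        by (simp add: algebra_simps power2_eq_square)
      then have "t\<^sup>2 * (2 * b\<^sup>2) \<le> t\<^sup>2 * (a\<^sup>2 - (t\<^sup>2 + 2) * b\<^sup>2)"
        using zero_le_power2[of b] by linarith
      then have "2 * b\<^sup>2 \<le> a\<^sup>2 - (t\<^sup>2 + 2) * b\<^sup>2"
        using t by (simp add: mult_le_cancel_left_pos)
      then show ?thesis
        using sol_ab by linarith
    qed
    then show ?thesis
      using nonneg sol_ab by blast
  qed
qed

text \<open>
  The norm of \<open>ty + k + y\<surd>m\<close> for \<open>k > 0\<close>. From \<open>y = 5\<close> on, the bound \<open>2y\<^sup>2 \<le> 4t + 1\<close> already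
  forces the value above \<open>4t + 1\<close>. For \<open>y = 3\<close> and \<open>y = 4\<close> the value is at least \<open>6t - 17\<close> and
  \<open>8t - 31\<close>; the first of these exceeds \<open>4t + 1\<close> exactly from \<open>t = 10\<close> on, which is the source of
  the bound on \<open>t\<close>.
\<close>

lemma small_norm_above:
  fixes t y k :: int
  assumes t: "t \<ge> 10" and y: "y \<ge> 1" and k: "k \<ge> 1"
    and y_small: "2 * y\<^sup>2 \<le> 4 * t + 1"
    and small: "2 * t * y * k + k\<^sup>2 - 2 * y\<^sup>2 \<le> 4 * t + 1"
  shows "k = 1 \<and> (y = 1 \<or> y = 2)"
proof -
  have k2: "k\<^sup>2 \<ge> 1" "k \<ge> 2 \<Longrightarrow> k\<^sup>2 \<ge> 4"
    using k power_mono[of 2 k 2] by simp_all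
  define P where "P = t * y * k"
  have small_P: "2 * P + k\<^sup>2 - 2 * y\<^sup>2 \<le> 4 * t + 1"
    using small by (simp add: P_def)
  have P: "t * y \<le> P" "k \<ge> 2 \<Longrightarrow> 2 * (t * y) \<le> P"
    using mult_left_mono[of 1 k "t * y"] mult_left_mono[of 2 k "t * y"] t y k
    by (simp_all add: P_def)
  have "y < 5"
  proof (rule ccontr)
    assume "\<not> y < 5"
    then have "t * 5 \<le> t * y"
      using t by (intro mult_left_mono) simp_all
    then show False
      using P(1) small_P y_small k2(1) t by linarith
  qed
  then consider "y = 1" | "y = 2" | "y = 3" | "y = 4"
    using y by linarith
  then have "\<not> k \<ge> 2 \<and> y \<le> 2"
    \<comment> \<open>\<open>P\<close> is opaque here, so for each fixed \<open>y\<close> everything is linear in \<open>t\<close>, \<open>P\<close> and \<open>k\<^sup>2\<close>.\<close>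
    by cases (use P k2 small_P t in auto)
  then show ?thesis
    using y k by linarith
qed

text \<open>
  The negated norm of \<open>ty - j + y\<surd>m\<close>. It equals \<open>j(2ty - j) + 2y\<^sup>2\<close>, which increases with \<open>j\<close>
  as long as \<open>j \<le> ty\<close>, so each lower bound on \<open>j\<close> can be inserted directly.
\<close>

lemma small_norm_below:
  fixes t y j :: int
  assumes t: "t \<ge> 5" and y: "y \<ge> 1" and j: "j \<ge> 1" "j \<le> t * y"
    and small: "2 * t * y * j - j\<^sup>2 + 2 * y\<^sup>2 \<le> 4 * t + 1"
  shows "y = 1 \<and> (j = 1 \<or> j = 2)"
proof -
  have incr: "2 * t * y * i - i\<^sup>2 \<le> 2 * t * y * j - j\<^sup>2" if "i \<le> j" for i
  proof -
    have "0 \<le> (j - i) * ((t * y - j) + (t * y - i))"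
      using that j by (intro mult_nonneg_nonneg) linarith+
    then show ?thesis
      by (simp add: algebra_simps power2_eq_square)
  qed
  have "y < 2"
  proof (rule ccontr)
    assume "\<not> y < 2"
    then have "t * 2 \<le> t * y" "y\<^sup>2 \<ge> 4"
      using t power_mono[of 2 y 2] by simp_all
    then show False
      using incr[of 1] j small by simp
  qed
  then have "y = 1"
    using y by simp
  moreover have "j < 3"
    using incr[of 3] small t \<open>y = 1\<close> by force
  ultimately show ?thesis
    using j by linarith
qed

theorem proposition5:
  fixes m n t :: nat
  assumes "m > 0" and "n > 0" and "t > 0"
    and "m = t ^ 2 + 2" and "t \<ge> 12"
    and "\<exists>x y :: int. \<bar>x ^ 2 - int m * y ^ 2\<bar> = int n"
    and "\<not> is_square (int n)"
    and "\<not> is_square (2 * int n)"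
  shows "int n = 2 * int t - 1 \<or> int n = 2 * int t + 1 \<or> int n = 4 * int t - 7
    \<or> int n = 4 * int t - 2 \<or> int n \<ge> 4 * int t + 2"
proof (rule ccontr)
  assume contra: "\<not> ?thesis"
  define T where "T = int t"
  define N where "N = int n"
  have T: "T \<ge> 12" and m: "int m = T\<^sup>2 + 2"
    using assms by (simp_all add: T_def)
  have N: "N \<le> 4 * T + 1" "N \<notin> {2 * T - 1, 2 * T + 1, 4 * T - 7, 4 * T - 2}"
    using contra by (auto simp: N_def T_def)
  obtain u v where "\<bar>u\<^sup>2 - (T\<^sup>2 + 2) * v\<^sup>2\<bar> = N"
    using assms(6) by (auto simp: m N_def)
  then obtain x y where x: "x \<ge> 0" and y: "y \<ge> 0"
    and sol: "\<bar>x\<^sup>2 - (T\<^sup>2 + 2) * y\<^sup>2\<bar> = N" and y_small: "2 * y\<^sup>2 \<le> N"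
    using exists_solution_small_y[of T u v N] T by auto
  define k where "k = x - T * y"
  have norm: "x\<^sup>2 - (T\<^sup>2 + 2) * y\<^sup>2 = 2 * T * y * k + k\<^sup>2 - 2 * y\<^sup>2"
    unfolding k_def by algebra
  have "y \<noteq> 0"
  proof
    assume "y = 0"
    then have "N = x\<^sup>2"
      using sol by simp
    then show False
      using assms(7) by (simp add: N_def)
  qed
  then have y1: "y \<ge> 1"
    using y by simp
  have "k \<noteq> 0"
  proof
    assume "k = 0"
    then have "2 * N = (2 * y)\<^sup>2"
      using sol norm by (simp add: power_mult_distrib)
    then show False
      using assms(8) by (metis N_def is_nth_power_nth_power)
  qed
  then consider (above) "k \<ge> 1" | (below) "- k \<ge> 1"
    by linarith
  then show False
  proof cases
    case above
    have "k = 1 \<and> (y = 1 \<or> y = 2)"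
      using small_norm_above[of T y k] T y1 above y_small N sol norm by linarith
    then show False
      using sol norm N T by auto
  next
    case below
    have j: "- k \<le> T * y"
      using x by (simp add: k_def)
    have "2 * T * y * (- k) - (- k)\<^sup>2 + 2 * y\<^sup>2 \<le> 4 * T + 1"
      using sol norm N by simp
    then have "y = 1 \<and> (- k = 1 \<or> - k = 2)"
      using small_norm_below[of T y "- k"] T y1 below j by simp
    then have "y = 1" "k = - 1 \<or> k = - 2"
      by linarith+
    then show False
      using sol norm N T by auto
  qed
qed

end
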